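(* For every finite group $G$ there exists an integer $d_G^*$ such that $$\left(\frac{a}{G}\right)_{el}=\left(\frac{d_G^*}{a}\right)$$ for all integers $a$ satisfying $(a,|G|)=1$.
   Context: For a finite group $G$ and an integer $a$ with $(a,|G|)=1$, the map $\rho_a:G\to G$, $g\mapsto g^a$, is a permutation of the set $G$; $\left(\frac{a}{G}\right)_{el}\in\{1,-1\}$ denotes its signature. $\left(\frac{n}{a}\right)$ is the Kronecker symbol for integers $n,a$: it is the Legendre symbol when $a$ is an odd prime, and it is determined by $\left(\frac{n}{a}\right)\left(\frac{n}{b}\right)=\left(\frac{n}{ab}\right)$; $\left(\frac{n}{2}\right)=0$ if $n$ is even, $1$ if $n\equiv 1,7 \pmod 8$, $-1$ if $n\equiv 3,5\pmod 8$; $\left(\frac{n}{-1}\right)=1$ if $n\ge 0$ and $-1$ if $n<0$; $\left(\frac{n}{0}\right)=1$ if $n=1$ and $0$ if $n\neq 1$. Convention: when $a$ is not odd and positive, the symbol $\left(\frac{n}{a}\right)$ is used only for $n\equiv 0,1\pmod 4$; the asserted equality, which includes negative $a$, is understood to include that the symbol is defined in this sense. *)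

theory Defs
  imports "HOL-Number_Theory.Number_Theory" "HOL-Combinatorics.Orbits"
begin

section \<open>The power permutation and its signature\<close>

text \<open>The library's sign is defined for permutations of the whole type, so the map
  \<open>g \<mapsto> g\<^sup>a\<close> is extended by the identity outside the carrier.\<close>

definition power_perm :: "('a, 'b) monoid_scheme \<Rightarrow> int \<Rightarrow> 'a \<Rightarrow> 'a" where
  "power_perm G a = perm_restrict (\<lambda>g. g [^]\<^bsub>G\<^esub> a) (carrier G)"

definition group_symbol_el :: "int \<Rightarrow> ('a, 'b) monoid_scheme \<Rightarrow> int" where
  "group_symbol_el a G = sign (power_perm G a)"

lemma power_perm_permutes:
  fixes G (structure)
  assumes "group G" "finite (carrier G)" "coprime a (int (Coset.order G))"
  shows "power_perm G a permutes carrier G"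
proof -
  interpret group G by fact
  let ?f = "\<lambda>g. g [^] a"
  obtain u v where uv: "u * a + v * int (Coset.order G) = 1"
    using assms(3) bezout_int[of a "int (Coset.order G)"] by (metis coprime_iff_gcd_eq_1)
  have inv: "(g [^] a) [^] u = g" if g: "g \<in> carrier G" for g
  proof -
    have "g [^] (v * int (Coset.order G)) = (g [^] Coset.order G) [^] v"
      using g by (simp add: int_pow_pow mult.commute flip: int_pow_int)
    hence "g [^] (v * int (Coset.order G)) = \<one>"
      using g by (simp add: pow_order_eq_1)
    moreover have "g = g [^] (u * a + v * int (Coset.order G))"
      using g by (simp add: uv)
    ultimately show ?thesis
      using g by (simp add: int_pow_mult int_pow_pow mult.commute)
  qed
  have "inj_on ?f (carrier G)"
    by (metis (no_types, lifting) inj_onI inv)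
  moreover have "?f ` carrier G \<subseteq> carrier G"
    by auto
  ultimately have "bij_betw ?f (carrier G) (carrier G)"
    using assms(2) by (simp add: bij_betw_def endo_inj_surj)
  hence "bij_betw (power_perm G a) (carrier G) (carrier G)"
    by (rule bij_betw_cong[THEN iffD1, rotated]) (simp add: power_perm_def perm_restrict_def)
  thus ?thesis
    by (rule bij_imp_permutes) (simp add: power_perm_def perm_restrict_def)
qed

section \<open>The Kronecker symbol\<close>

definition kronecker_two :: "int \<Rightarrow> int" where
  "kronecker_two n =
     (if even n then 0 else if n mod 8 = 1 \<or> n mod 8 = 7 then 1 else -1)"

definition kronecker_neg_one :: "int \<Rightarrow> int" where
  "kronecker_neg_one n = (if n \<ge> 0 then 1 else -1)"

text \<open>For negative \<open>a\<close>, the prime factorization of \<open>a\<close> is that of \<open>\<bar>a\<bar>\<close>;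
  its elements are positive.\<close>

definition kronecker :: "int \<Rightarrow> int \<Rightarrow> int" where
  "kronecker n a =
     (if a = 0 then (if n = 1 then 1 else 0)
      else (if a < 0 then kronecker_neg_one n else 1) *
           (\<Prod>p\<in>#prime_factorization a. if p = 2 then kronecker_two n else Legendre n p))"

text \<open>The function \<open>kronecker\<close> is total. The symbol is used only for arguments
  satisfying the following condition.\<close>

definition kronecker_defined :: "int \<Rightarrow> int \<Rightarrow> bool" where
  "kronecker_defined n a \<longleftrightarrow> (odd a \<and> a > 0) \<or> [n = 0] (mod 4) \<or> [n = 1] (mod 4)"

lemma kronecker_odd_prime: "prime p \<Longrightarrow> p \<noteq> 2 \<Longrightarrow> kronecker n p = Legendre n p"
  by (auto simp: kronecker_def prime_factorization_prime dest: prime_gt_0_int)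

lemma kronecker_2: "kronecker n 2 = kronecker_two n"
  by (simp add: kronecker_def prime_factorization_prime)

lemma kronecker_minus_1: "kronecker n (-1) = kronecker_neg_one n"
  by (simp add: kronecker_def prime_factorization_unit)

lemma kronecker_0: "kronecker n 0 = (if n = 1 then 1 else 0)"
  by (simp add: kronecker_def)

lemma Legendre_1_left: "prime p \<Longrightarrow> Legendre 1 p = 1"
  using prime_gt_1_int[of p] unfolding Legendre_def QuadRes_def
  by (auto simp: cong_def intro: exI[of _ 1])

lemma kronecker_1_left: "kronecker 1 a = 1"
proof -
  have "(\<Prod>p\<in>#prime_factorization a. if p = 2 then kronecker_two 1 else Legendre 1 p)
        = (\<Prod>p\<in>#prime_factorization a. 1)"
    by (intro arg_cong[where f = prod_mset] image_mset_cong)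
       (auto simp: kronecker_two_def Legendre_1_left in_prime_factors_imp_prime)
  thus ?thesis
    by (simp add: kronecker_def kronecker_neg_one_def)
qed

lemma kronecker_mult: "kronecker n a * kronecker n b = kronecker n (a * b)"
proof (cases "a = 0 \<or> b = 0")
  case True
  thus ?thesis by (cases "n = 1") (auto simp: kronecker_1_left kronecker_0)
next
  case False
  thus ?thesis
    by (auto simp: kronecker_def prime_factorization_mult kronecker_neg_one_def
        mult_less_0_iff zero_less_mult_iff)
qed

end

theory Submission
  imports Defs
begin

text \<open>Let \<open>n\<close> be the order of \<open>G\<close>. The power map depends only on \<open>a\<close> modulo \<open>n\<close>, and
  composing power maps multiplies exponents. Since the sign of permutations is multiplicative,
  \<open>a \<mapsto> group_symbol_el a G\<close> is a real character modulo \<open>n\<close>, that is, a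
  \<open>\<plusminus>1\<close>-valued multiplicative function of the residues prime to \<open>n\<close>
  (\<open>real_character_group_symbol_el\<close>). The theorem is therefore an
  instance of the classical fact that every real character is given by a Kronecker symbol
  (\<open>real_character_is_kronecker\<close>).

  By the Chinese remainder theorem a real character is a product of real characters of prime power
  moduli (\<open>real_character_split\<close>), and the Kronecker symbol is multiplicative in its upper
  argument, so prime power moduli suffice. For an odd prime \<open>p\<close>, a quadratic residue modulo
  \<open>p\<close> becomes, after raising to a suitable odd power, a square modulo \<open>p\<^sup>k\<close>; hence the
  character is trivial on quadratic residues and is either trivial or the Legendre symbol
  \<open>a \<mapsto> (a/p)\<close>. By quadratic reciprocity and its supplements, the latter is the Kronecker
  symbol of \<open>p\<close> or \<open>-p\<close>, whichever is \<open>1\<close> modulo \<open>4\<close>. Modulo a power of \<open>2\<close>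
  every \<open>a \<equiv> 1\<close> modulo \<open>8\<close> is a square, so the character is one of the four real
  characters modulo \<open>8\<close>, which are the Kronecker symbols of \<open>4\<close>, \<open>-4\<close>, \<open>8\<close> and
  \<open>-8\<close>. All these upper arguments are \<open>0\<close> or \<open>1\<close> modulo \<open>4\<close>, and so is their
  product; this is what makes the symbol defined for even and for negative \<open>a\<close>.\<close>

section \<open>Legendre symbols\<close>

lemma Legendre_cong: "[a = b] (mod p) \<Longrightarrow> Legendre a p = Legendre b p"
  by (auto simp: Legendre_def QuadRes_def dest: cong_trans cong_sym)

lemma Legendre_values: "\<not> p dvd a \<Longrightarrow> Legendre a p \<in> {1, -1}"
  by (auto simp: Legendre_def cong_0_iff)

text \<open>Identities between Legendre symbols come out of Euler's criterion only as congruences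
  modulo \<open>p\<close>; for \<open>p > 2\<close> the three possible values are pairwise incongruent.\<close>

lemma cong_small_imp_eq:
  fixes p x y :: int
  assumes "p > 2" "x \<in> {-1, 0, 1}" "y \<in> {-1, 0, 1}" "[x = y] (mod p)"
  shows "x = y"
proof (rule ccontr)
  assume "x \<noteq> y"
  moreover have "p dvd x - y"
    using assms(4) by (simp add: cong_iff_dvd_diff)
  ultimately have "\<bar>p\<bar> \<le> \<bar>x - y\<bar>"
    by (intro dvd_imp_le_int) auto
  with assms(1-3) \<open>p dvd x - y\<close> \<open>x \<noteq> y\<close> show False
    by auto
qed

lemma prime_int_gt_2: "prime (p :: int) \<Longrightarrow> p \<noteq> 2 \<Longrightarrow> p > 2"
  using prime_ge_2_int[of p] by simp

lemma euler_criterion_int: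
  fixes p :: int
  assumes "prime p" "p \<noteq> 2"
  shows "[Legendre a p = a ^ ((nat p - 1) div 2)] (mod p)"
  using euler_criterion[of "nat p" a] assms prime_int_gt_2[OF assms] by simp

lemma Legendre_mult:
  fixes p :: int
  assumes "prime p" "p \<noteq> 2"
  shows "Legendre (a * b) p = Legendre a p * Legendre b p"
proof (rule cong_small_imp_eq)
  show "p > 2" by (rule prime_int_gt_2[OF assms])
  have "[Legendre a p * Legendre b p = a ^ ((nat p - 1) div 2) * b ^ ((nat p - 1) div 2)] (mod p)"
    by (intro cong_mult euler_criterion_int assms)
  thus "[Legendre (a * b) p = Legendre a p * Legendre b p] (mod p)"
    using euler_criterion_int[OF assms, of "a * b"]
    by (simp add: power_mult_distrib) (meson cong_sym cong_trans)
qed (auto simp: Legendre_def)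

lemma odd_prime_mod_4:
  fixes p :: int
  assumes "prime p" "p \<noteq> 2"
  shows "odd p" "p mod 4 = 1 \<or> p mod 4 = 3"
proof -
  show "odd p"
    using prime_int_gt_2[OF assms] assms(1) prime_odd_int by blast
  thus "p mod 4 = 1 \<or> p mod 4 = 3" by presburger
qed

lemma Legendre_minus_one:
  fixes p :: int
  assumes "prime p" "p \<noteq> 2"
  shows "Legendre (-1) p = (if p mod 4 = 1 then 1 else -1)"
proof -
  have p: "p > 2" "odd p"
    using prime_int_gt_2[OF assms] odd_prime_mod_4[OF assms] by auto
  have "(nat p - 1) div 2 = nat ((p - 1) div 2)"
    using p by linarith
  moreover have "even ((p - 1) div 2) \<longleftrightarrow> p mod 4 = 1"
    using p(2) by presburger
  ultimately have ev: "even ((nat p - 1) div 2) \<longleftrightarrow> p mod 4 = 1"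
    using p(1) by (simp add: even_nat_iff)
  show ?thesis
  proof (rule cong_small_imp_eq[OF p(1)])
    show "[Legendre (-1) p = (if p mod 4 = 1 then 1 else -1)] (mod p)"
      using euler_criterion_int[OF assms, of "-1"] ev
      by (cases "p mod 4 = 1") auto
  qed (auto simp: Legendre_def)
qed

text \<open>Gauss's lemma for the multiplier \<open>2\<close>: with \<open>h = (p - 1) / 2\<close>, the doubles of
  \<open>1, \<dots>, h\<close> are already reduced modulo \<open>p\<close>, and those that exceed \<open>h\<close> are the
  doubles of \<open>\<lfloor>h / 2\<rfloor> + 1, \<dots>, h\<close>.\<close>

lemma Legendre_two:
  fixes p :: int
  assumes "prime p" "p \<noteq> 2"
  shows "Legendre 2 p = kronecker_two p"
proof -
  have p: "p > 2" "odd p"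
    using prime_int_gt_2[OF assms] odd_prime_mod_4[OF assms] by auto
  interpret GAUSS "nat p" 2
  proof
    have "\<not> p dvd 2"
      using p zdvd_not_zless[of 2 p] by auto
    thus "[2 \<noteq> 0] (mod int (nat p))"
      using p by (simp add: cong_0_iff)
  qed (use p assms in auto)
  define h where "h = (p - 1) div 2"
  have h: "p = 2 * h + 1" "h > 0"
    using p by (auto simp: h_def)
  have "C = (\<lambda>x. 2 * x) ` {0<..h}"
    using h unfolding C_def B_def A_def by (simp add: image_image mult.commute)
  moreover have "(int (nat p) - 1) div 2 = h"
    using p(1) by (simp add: h_def)
  ultimately have "E = (\<lambda>x. 2 * x) ` {0<..h} \<inter> {h<..}"
    by (simp only: E_def)
  also have "\<dots> = (\<lambda>x. 2 * x) ` {h div 2<..h}"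
    using h(2) by auto
  finally have "card E = nat (h - h div 2)"
    by (simp add: card_image inj_on_def)
  moreover have "even (h - h div 2) \<longleftrightarrow> p mod 8 = 1 \<or> p mod 8 = 7"
    unfolding h(1) by presburger
  hence "even (nat (h - h div 2)) \<longleftrightarrow> p mod 8 = 1 \<or> p mod 8 = 7"
    using h(2) by (simp add: even_nat_iff)
  ultimately show ?thesis
    using gauss_lemma p by (simp add: kronecker_two_def)
qed

text \<open>For an odd prime \<open>p\<close> this is the discriminant of the quadratic field that is ramified
  exactly at \<open>p\<close>. The sign makes it \<open>1\<close> modulo \<open>4\<close> and absorbs the sign in quadratic
  reciprocity.\<close>

definition prime_discriminant :: "int \<Rightarrow> int" where
  "prime_discriminant p = (if p mod 4 = 1 then p else - p)"

lemma Legendre_prime_discriminant: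
  fixes p q :: int
  assumes p: "prime p" "p \<noteq> 2" and q: "prime q" "q \<noteq> 2" and "p \<noteq> q"
  shows "Legendre (prime_discriminant p) q = Legendre q p"
proof -
  have gt: "p > 2" "q > 2"
    using prime_int_gt_2 p q by auto
  have nd: "\<not> p dvd q" "\<not> q dvd p"
    using assms primes_dvd_imp_eq by blast+
  have parity: "even (nat ((p - 1) div 2 * ((q - 1) div 2))) \<longleftrightarrow> p mod 4 = 1 \<or> q mod 4 = 1"
  proof -
    have "even ((r - 1) div 2) \<longleftrightarrow> r mod 4 = 1" if "odd r" for r :: int
      using that by presburger
    thus ?thesis
      using odd_prime_mod_4(1)[OF p] odd_prime_mod_4(1)[OF q] gt by (simp add: even_nat_iff)
  qed
  have "Legendre p q * Legendre q p = (-1) ^ nat ((p - 1) div 2 * ((q - 1) div 2))"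
    by (rule Quadratic_Reciprocity_int) (use p q gt assms in auto)
  hence rec: "Legendre p q * Legendre q p = (if p mod 4 = 1 \<or> q mod 4 = 1 then 1 else -1)"
    using parity by simp
  have neg: "Legendre (- p) q = Legendre (-1) q * Legendre p q"
    using Legendre_mult[OF q, of "-1" p] by simp
  show ?thesis
    using rec neg Legendre_minus_one[OF q] Legendre_values[OF nd(1)] Legendre_values[OF nd(2)]
    by (auto simp: prime_discriminant_def split: if_splits)
qed

section \<open>Real characters\<close>

text \<open>Only the values at arguments prime to \<open>n\<close> are constrained, so that functions with
  arbitrary values elsewhere, such as \<open>a \<mapsto> group_symbol_el a G\<close>, qualify.\<close>

definition real_character :: "int \<Rightarrow> (int \<Rightarrow> int) \<Rightarrow> bool" where
  "real_character n \<chi> \<longleftrightarrow>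
     (\<forall>a. coprime a n \<longrightarrow> \<chi> a \<in> {1, -1}) \<and>
     (\<forall>a b. coprime a n \<longrightarrow> coprime b n \<longrightarrow> \<chi> (a * b) = \<chi> a * \<chi> b) \<and>
     (\<forall>a b. coprime a n \<longrightarrow> [a = b] (mod n) \<longrightarrow> \<chi> a = \<chi> b)"

lemma real_characterD:
  assumes "real_character n \<chi>" "coprime a n"
  shows real_character_values: "\<chi> a \<in> {1, -1}"
    and real_character_mult: "coprime b n \<Longrightarrow> \<chi> (a * b) = \<chi> a * \<chi> b"
    and real_character_cong: "[a = b] (mod n) \<Longrightarrow> \<chi> a = \<chi> b"
  using assms unfolding real_character_def by blast+

lemma real_character_square:
  assumes "real_character n \<chi>" "coprime a n"
  shows "\<chi> (a * a) = 1"
  using real_character_mult[OF assms assms(2)] real_character_values[OF assms] by auto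

lemma real_character_one: "real_character n \<chi> \<Longrightarrow> \<chi> 1 = 1"
  using real_character_square[of n \<chi> 1] by simp

lemma real_character_odd_power:
  assumes "real_character n \<chi>" "coprime a n" "odd k"
  shows "\<chi> (a ^ k) = \<chi> a"
proof -
  have "\<chi> (a ^ j) = \<chi> a ^ j" for j
    using assms(1,2)
    by (induction j) (auto simp: real_character_one real_character_mult[of n \<chi>])
  moreover have "\<chi> a ^ k = \<chi> a"
    using real_character_values[OF assms(1,2)] assms(3) by auto
  ultimately show ?thesis by simp
qed

text \<open>Both sides are multiplicative, so agreement at \<open>-1\<close> and at the primes not dividing
  \<open>n\<close> is enough. At \<open>0\<close>, which is prime to \<open>n\<close> when \<open>n = 1\<close>, they may differ.\<close>

lemma real_character_eq_kronecker:
  assumes \<chi>: "real_character n \<chi>"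
    and m1: "\<chi> (-1) = kronecker_neg_one d"
    and two: "odd n \<Longrightarrow> \<chi> 2 = kronecker_two d"
    and odd: "\<And>q. prime q \<Longrightarrow> q \<noteq> 2 \<Longrightarrow> coprime q n \<Longrightarrow> \<chi> q = Legendre d q"
    and a: "a \<noteq> 0" "coprime a n"
  shows "\<chi> a = kronecker d a"
  using a
proof (induction a rule: prime_divisors_induct)
  case (unit x)
  hence "x = 1 \<or> x = -1" by auto
  thus ?case
    using m1 real_character_one[OF \<chi>] kronecker_minus_1 by (auto simp: kronecker_def)
next
  case (factor q x)
  hence cop: "coprime q n" "coprime x n" and "x \<noteq> 0" by auto
  have "\<chi> q = kronecker d q"
  proof (cases "q = 2")
    case True
    thus ?thesis using two cop(1) by (simp add: kronecker_2)
  next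
    case False
    thus ?thesis using odd factor.hyps cop(1) by (simp add: kronecker_odd_prime)
  qed
  moreover have "\<chi> x = kronecker d x"
    using factor.IH cop(2) \<open>x \<noteq> 0\<close> by simp
  ultimately show ?case
    using real_character_mult[OF \<chi> cop] by (simp add: kronecker_mult)
qed simp

lemma real_character_Legendre:
  assumes "prime p" "p \<noteq> 2"
  shows "real_character p (\<lambda>a. Legendre a p)"
proof -
  have "\<not> p dvd a" if "coprime a p" for a
    using that assms(1) by (metis coprime_absorb_right not_prime_unit)
  thus ?thesis
    using Legendre_values[of p] Legendre_mult[OF assms] Legendre_cong[of _ _ p]
    unfolding real_character_def by blast
qed

text \<open>Each of the three kinds of generators in \<open>real_character_eq_kronecker\<close> is one part of the
  reciprocity law: \<open>-1\<close> and \<open>2\<close> are the two supplements, odd primes the main law.\<close>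

lemma kronecker_prime_discriminant:
  assumes p: "prime p" "p \<noteq> 2" and "coprime a p"
  shows "kronecker (prime_discriminant p) a = Legendre a p"
proof (rule sym, rule real_character_eq_kronecker[OF real_character_Legendre[OF p]])
  have gt: "p > 2" by (rule prime_int_gt_2[OF p])
  show "Legendre (-1) p = kronecker_neg_one (prime_discriminant p)"
    using gt by (simp add: Legendre_minus_one[OF p] prime_discriminant_def kronecker_neg_one_def)
  have "(- p) mod 8 = 1 \<longleftrightarrow> p mod 8 = 7" "(- p) mod 8 = 7 \<longleftrightarrow> p mod 8 = 1"
    by presburger+
  thus "Legendre 2 p = kronecker_two (prime_discriminant p)"
    by (auto simp: Legendre_two[OF p] prime_discriminant_def kronecker_two_def)
  show "Legendre q p = Legendre (prime_discriminant p) q"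
    if "prime q" "q \<noteq> 2" "coprime q p" for q
    using that p Legendre_prime_discriminant[OF p, of q] by (metis coprime_self not_prime_unit)
  show "a \<noteq> 0"
    using assms by auto
qed fact

section \<open>Prime power moduli\<close>

text \<open>In \<open>a\<^sup>p - b\<^sup>p = (a - b) (a\<^sup>p\<^sup>-\<^sup>1 + \<dots> + b\<^sup>p\<^sup>-\<^sup>1)\<close> the second factor consists of \<open>p\<close> terms
  that are all congruent modulo \<open>p\<close>, and so contributes a further factor \<open>p\<close>.\<close>

lemma cong_power_prime_lift:
  fixes a b p :: int
  assumes "[a = b] (mod p ^ Suc k)" "p > 0"
  shows "[a ^ nat p = b ^ nat p] (mod p ^ Suc (Suc k))"
proof -
  have ab: "[a = b] (mod p)"
    using assms(1) by (rule cong_dvd_modulus) simp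
  have "[(\<Sum>i<nat p. b ^ (nat p - Suc i) * a ^ i) = (\<Sum>i<nat p. b ^ (nat p - 1))] (mod p)"
  proof (rule cong_sum)
    fix i assume "i \<in> {..<nat p}"
    hence "b ^ (nat p - 1) = b ^ (nat p - Suc i) * b ^ i"
      by (simp flip: power_add)
    thus "[b ^ (nat p - Suc i) * a ^ i = b ^ (nat p - 1)] (mod p)"
      using ab by (simp add: cong_mult cong_pow)
  qed
  also have "(\<Sum>i<nat p. b ^ (nat p - 1)) = p * b ^ (nat p - 1)"
    using assms(2) by simp
  finally have "p dvd (\<Sum>i<nat p. b ^ (nat p - Suc i) * a ^ i)"
    by (metis cong_dvd_iff dvd_triv_left)
  moreover have "p ^ Suc k dvd a - b"
    using assms(1) by (simp add: cong_iff_dvd_diff)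
  ultimately have "p ^ Suc k * p dvd (a - b) * (\<Sum>i<nat p. b ^ (nat p - Suc i) * a ^ i)"
    by (rule mult_dvd_mono[rotated])
  thus ?thesis
    by (simp add: cong_iff_dvd_diff power_diff_sumr2 mult_ac)
qed

lemma cong_prime_power_power:
  fixes a b p :: int
  assumes "[a = b] (mod p)" "p > 0"
  shows "[a ^ (nat p ^ k) = b ^ (nat p ^ k)] (mod p ^ Suc k)"
proof (induction k)
  case (Suc k)
  from cong_power_prime_lift[OF this assms(2)] show ?case
    by (simp only: power_mult[symmetric] power_Suc mult_ac)
qed (use assms in simp)

text \<open>If \<open>a \<equiv> y\<^sup>2\<close> modulo \<open>p\<close>, then raising to the power \<open>p\<^sup>k\<close> turns this
  into a congruence modulo \<open>p\<^sup>k\<^sup>+\<^sup>1\<close>, while \<open>\<chi> a\<close> is unchanged because the exponent is odd.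
  Hence \<open>\<chi>\<close> is \<open>1\<close> on quadratic residues. The product of two nonresidues is a residue, so
  \<open>\<chi>\<close> is constant on nonresidues.\<close>

lemma real_character_odd_prime_power:
  assumes p: "prime p" "p \<noteq> 2" and \<chi>: "real_character (p ^ Suc k) \<chi>"
  shows "\<exists>d\<in>{1, prime_discriminant p}. \<forall>a. coprime a p \<longrightarrow> \<chi> a = kronecker d a"
proof -
  have gt: "p > 2" by (rule prime_int_gt_2[OF p])
  have res: "\<chi> a = 1" if a: "coprime a p" "Legendre a p = 1" for a
  proof -
    from a(2) obtain y where y: "[y * y = a] (mod p)"
      by (auto simp: Legendre_def QuadRes_def power2_eq_square split: if_splits)
    have "coprime (y * y) p"
      using a(1) y cong_imp_coprime cong_sym by blast
    hence cy: "coprime y p" by simp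
    have "odd (nat p ^ k)"
      using odd_prime_mod_4(1)[OF p] gt by (simp add: even_nat_iff)
    hence "\<chi> a = \<chi> (a ^ (nat p ^ k))"
      using real_character_odd_power[OF \<chi>] a(1) by simp
    also have "\<dots> = \<chi> ((y * y) ^ (nat p ^ k))"
      by (rule real_character_cong[OF \<chi>])
        (use a y gt cong_prime_power_power[of a "y * y" p k] in \<open>auto simp: cong_sym\<close>)
    also have "\<dots> = \<chi> (y ^ (nat p ^ k) * y ^ (nat p ^ k))"
      by (simp add: power_mult_distrib)
    also have "\<dots> = 1"
      by (rule real_character_square[OF \<chi>]) (use cy in auto)
    finally show ?thesis .
  qed
  note leg = real_character_Legendre[OF p]
  show ?thesis
  proof (cases "\<exists>g. coprime g p \<and> \<chi> g \<noteq> 1")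
    case False
    thus ?thesis by (auto simp: kronecker_1_left)
  next
    case True
    then obtain g where g: "coprime g p" "\<chi> g \<noteq> 1" by blast
    hence g': "\<chi> g = -1" "Legendre g p = -1"
      using real_character_values[OF \<chi>, of g] real_character_values[OF leg, of g] res[of g] by auto
    have "\<chi> a = Legendre a p" if a: "coprime a p" for a
    proof (cases "Legendre a p = 1")
      case False
      hence "Legendre a p = -1"
        using real_character_values[OF leg a] by auto
      hence "Legendre (a * g) p = 1"
        using real_character_mult[OF leg a g(1)] g' by simp
      hence "\<chi> (a * g) = 1"
        using res a g(1) by simp
      thus ?thesis
        using real_character_mult[OF \<chi>, of a g] a g g' \<open>Legendre a p = -1\<close> by auto
    qed (use res a in auto)
    thus ?thesis
      using kronecker_prime_discriminant[OF p] by auto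
  qed
qed

lemma odd_mod_8: "odd a \<Longrightarrow> a mod 8 \<in> {1, 3, 5, 7}" for a :: int
  by (simp; presburger)

lemma coprime_8_iff: "coprime a 8 \<longleftrightarrow> odd a" for a :: int
proof -
  have "coprime a (2 ^ 3) \<longleftrightarrow> odd a"
    by (subst coprime_power_right_iff) auto
  thus ?thesis by simp
qed

text \<open>Hensel lifting by hand. Passing from the modulus \<open>2\<^sup>k\<^sup>+\<^sup>3\<close> to its double, a root
  \<open>y\<close> either still works or is corrected by \<open>2\<^sup>k\<^sup>+\<^sup>2\<close>: as \<open>y\<close> is odd, this changes the
  square by \<open>2\<^sup>k\<^sup>+\<^sup>3\<close> modulo \<open>2\<^sup>k\<^sup>+\<^sup>4\<close>.\<close>

lemma square_mod_power_2:
  fixes a :: int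
  assumes "[a = 1] (mod 8)"
  shows "\<exists>y. odd y \<and> [y * y = a] (mod 2 ^ (k + 3))"
proof (induction k)
  case 0
  show ?case using assms by (intro exI[of _ 1]) (auto simp: cong_sym)
next
  case (Suc k)
  then obtain y t where y: "odd y" "a = y * y + 2 ^ (k + 3) * t"
    by (metis cong_iff_lin mult.commute)
  obtain u where u: "y = 2 * u + 1" using y(1) by (elim oddE)
  show ?case
  proof (cases "even t")
    case True
    then obtain s where "t = 2 * s" by (elim evenE)
    hence "a = y * y + s * 2 ^ (Suc k + 3)" by (simp add: y(2) power_add)
    thus ?thesis using y(1) by (metis cong_iff_lin mult.commute)
  next
    case False
    then obtain s where s: "t = 2 * s + 1" by (elim oddE)
    let ?z = "y + 2 ^ (k + 2)"
    have "a = ?z * ?z + (s - u - 2 ^ k) * 2 ^ (Suc k + 3)"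
      by (simp add: y(2) u s algebra_simps power_add power2_eq_square)
    moreover have "odd ?z" using y(1) by simp
    ultimately show ?thesis by (metis cong_iff_lin mult.commute)
  qed
qed

text \<open>A real character is \<open>1\<close> on squares, and modulo a power of \<open>2\<close> every number that is
  \<open>1\<close> modulo \<open>8\<close> is a square. If odd \<open>a\<close> and \<open>b\<close> agree modulo \<open>8\<close>, this applies to
  \<open>a * b\<close>. For moduli \<open>2\<close> and \<open>4\<close> the conclusion merely passes to a multiple of the
  modulus.\<close>

lemma real_character_power_2_mod_8:
  assumes \<chi>: "real_character (2 ^ Suc k) \<chi>"
  shows "real_character 8 \<chi>"
proof -
  note c8 = coprime_8_iff
  have ck: "coprime a (2 ^ Suc k) \<longleftrightarrow> odd a" for a :: int
    by (subst coprime_power_right_iff) auto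
  have one: "\<chi> a = 1" if "[a = 1] (mod 8)" for a
  proof -
    obtain y where y: "odd y" "[y * y = a] (mod 2 ^ (k + 3))"
      using square_mod_power_2[OF \<open>[a = 1] (mod 8)\<close>] by blast
    have "[y * y = a] (mod 2 ^ Suc k)"
      using y(2) by (rule cong_dvd_modulus) (rule le_imp_power_dvd, simp)
    hence "\<chi> a = \<chi> (y * y)"
      using y(1) ck by (intro real_character_cong[OF \<chi>, symmetric]) auto
    also have "\<dots> = 1"
      using y(1) ck by (intro real_character_square[OF \<chi>]) auto
    finally show ?thesis .
  qed
  have per: "\<chi> a = \<chi> b" if "odd a" "[a = b] (mod 8)" for a b
  proof -
    have b: "odd b" using that by (metis c8 cong_imp_coprime)
    have "[a * b = b * b] (mod 8)"
      using that(2) by (rule cong_scalar_right)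
    moreover have "(b * b) mod 8 = ((b mod 8) * (b mod 8)) mod 8"
      by (simp add: mod_simps)
    hence "[b * b = 1] (mod 8)"
      using odd_mod_8[OF b] by (auto simp: cong_def)
    ultimately have "\<chi> (a * b) = 1"
      using one cong_trans by blast
    moreover have "coprime a (2 ^ Suc k)" "coprime b (2 ^ Suc k)"
      using that(1) b ck by blast+
    ultimately have "\<chi> a * \<chi> b = 1" "\<chi> a \<in> {1, -1}" "\<chi> b \<in> {1, -1}"
      using real_character_mult[OF \<chi>] real_character_values[OF \<chi>] by metis+
    thus ?thesis by auto
  qed
  show ?thesis
    using \<chi> per unfolding real_character_def c8 ck by blast
qed

lemma real_character_power_2:
  assumes "real_character (2 ^ Suc k) \<chi>"
  shows "\<exists>d\<in>{4, -4, 8, -8}. \<forall>a. odd a \<longrightarrow> \<chi> a = kronecker d a"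
proof -
  have \<chi>: "real_character 8 \<chi>" by (rule real_character_power_2_mod_8[OF assms])
  note c8 = coprime_8_iff
  have v3: "\<chi> 3 \<in> {1, -1}" and v5: "\<chi> 5 \<in> {1, -1}"
    using real_character_values[OF \<chi>] c8 by auto
  have "\<chi> 7 = \<chi> (3 * 5)"
    by (rule real_character_cong[OF \<chi>]) (auto simp: c8 cong_def)
  hence c7: "\<chi> 7 = \<chi> 3 * \<chi> 5"
    using real_character_mult[OF \<chi>, of 3 5] c8 by simp
  have m1: "\<chi> (-1) = \<chi> 7"
    by (rule real_character_cong[OF \<chi>]) (auto simp: cong_def)
  have red: "\<chi> q = \<chi> (q mod 8)" if "odd q" for q
    by (rule real_character_cong[OF \<chi>]) (use that c8 in auto)
  \<comment> \<open>The residues \<open>3\<close> and \<open>5\<close> generate the units modulo \<open>8\<close>, so the values there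
    determine the character. For the trivial character \<open>d = 4\<close> serves as well as \<open>d = 1\<close>, since
    all arguments are odd.\<close>
  define d :: int where
    "d = (if \<chi> 3 = 1 then if \<chi> 5 = 1 then 4 else -8 else if \<chi> 5 = 1 then -4 else 8)"
  have "\<chi> a = kronecker d a" if "odd a" for a
  proof (rule real_character_eq_kronecker[OF \<chi>])
    show "\<chi> (-1) = kronecker_neg_one d"
      using v3 v5 m1 c7 by (auto simp: d_def kronecker_neg_one_def)
    fix q :: int assume q: "prime q" "q \<noteq> 2"
    have oq: "odd q" by (rule odd_prime_mod_4[OF q])
    note mult = Legendre_mult[OF q]
    have sq: "Legendre 2 q * Legendre 2 q = 1"
      using oq by (simp add: Legendre_two[OF q] kronecker_two_def)
    have "Legendre 4 q = 1" "Legendre 8 q = Legendre 2 q"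
      using mult[of 2 2] mult[of 4 2] sq by auto
    moreover have "Legendre (-4) q = Legendre (-1) q" "Legendre (-8) q = Legendre (-1) q * Legendre 2 q"
      using mult[of "-1" 4] mult[of "-1" 8] calculation by auto
    moreover have "q mod 8 \<in> {1, 3, 5, 7}"
      by (rule odd_mod_8[OF oq])
    moreover have "q mod 4 = (q mod 8) mod 4"
      by (simp add: mod_mod_cancel)
    ultimately show "\<chi> q = Legendre d q"
      using v3 v5 c7 red[OF oq] real_character_one[OF \<chi>] oq
      by (auto simp: d_def Legendre_two[OF q] Legendre_minus_one[OF q] kronecker_two_def)
  qed (use that c8 in auto)
  moreover have "d \<in> {4, -4, 8, -8}" by (simp add: d_def)
  ultimately show ?thesis by blast
qed

section \<open>Composite moduli\<close>

text \<open>The symbol with lower argument \<open>-1\<close> is multiplicative only on nonzero integers, since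
  it takes the value \<open>1\<close> at \<open>0\<close>; the symbol with lower argument \<open>0\<close> is not
  multiplicative, since \<open>(-1) * (-1) = 1\<close>.\<close>

lemma kronecker_mult_left:
  assumes "d \<noteq> 0" "e \<noteq> 0" "a \<noteq> 0"
  shows "kronecker (d * e) a = kronecker d a * kronecker e a"
proof -
  have neg: "kronecker_neg_one (d * e) = kronecker_neg_one d * kronecker_neg_one e"
    using assms by (auto simp: kronecker_neg_one_def zero_le_mult_iff)
  have two: "kronecker_two (d * e) = kronecker_two d * kronecker_two e"
  proof (cases "odd d \<and> odd e")
    case True
    hence "d mod 8 \<in> {1, 3, 5, 7}" "e mod 8 \<in> {1, 3, 5, 7}"
      using odd_mod_8 by blast+
    moreover have "(d * e) mod 8 = ((d mod 8) * (e mod 8)) mod 8"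
      by (simp add: mod_simps)
    ultimately show ?thesis
      using True by (auto simp: kronecker_two_def)
  qed (auto simp: kronecker_two_def)
  have "(\<Prod>p\<in>#prime_factorization a. if p = 2 then kronecker_two (d * e) else Legendre (d * e) p) =
        (\<Prod>p\<in>#prime_factorization a. (if p = 2 then kronecker_two d else Legendre d p) *
           (if p = 2 then kronecker_two e else Legendre e p))"
    by (intro arg_cong[where f = prod_mset] image_mset_cong)
      (auto simp: two Legendre_mult in_prime_factors_imp_prime)
  thus ?thesis
    using assms by (simp add: kronecker_def neg prod_mset.distrib)
qed

text \<open>The map \<open>a \<mapsto> 1 + u * l * (a - 1)\<close> is the explicit Chinese remainder solution: it is
  \<open>a\<close> modulo \<open>m\<close> and \<open>1\<close> modulo \<open>l\<close>, because \<open>u * l\<close> is \<open>1\<close> modulo \<open>m\<close>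
  and \<open>0\<close> modulo \<open>l\<close>. Composing with it isolates the part of \<open>\<chi>\<close> that lives at
  \<open>m\<close>.\<close>

lemma real_character_component:
  fixes m l u v :: int
  assumes \<chi>: "real_character (m * l) \<chi>" and uv: "u * l + v * m = 1"
  shows "real_character m (\<lambda>a. \<chi> (1 + u * l * (a - 1)))"
proof -
  define f where "f a = 1 + u * l * (a - 1)" for a
  have fl: "[f a = 1] (mod l)" for a
    by (simp add: f_def cong_iff_dvd_diff)
  have fm: "[f a = a] (mod m)" for a
  proof -
    have "f a - a = (1 - u * l) * (1 - a)" by (simp add: f_def algebra_simps)
    also have "1 - u * l = v * m" using uv by simp
    finally show ?thesis by (simp add: cong_iff_dvd_diff)
  qed
  have cop: "coprime (f a) (m * l)" if "coprime a m" for a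
    using that cong_imp_coprime[OF cong_sym[OF fm]] cong_imp_coprime[OF cong_sym[OF fl]] by simp
  have "coprime m l"
    using uv by (metis coprime_iff_gcd_eq_1 gcd_dvd1 gcd_dvd2 dvd_add dvd_mult is_unit_gcd_iff)
  hence glue: "[x = y] (mod m * l)" if "[x = y] (mod m)" "[x = y] (mod l)" for x y
    using that coprime_cong_mult by blast
  have "\<chi> (f (a * b)) = \<chi> (f a) * \<chi> (f b)" if "coprime a m" "coprime b m" for a b
  proof -
    have "[f (a * b) = f a * f b] (mod m * l)"
    proof (rule glue)
      show "[f (a * b) = f a * f b] (mod m)"
        using fm cong_mult[OF fm fm] cong_sym cong_trans by meson
      show "[f (a * b) = f a * f b] (mod l)"
        using fl cong_mult[OF fl fl] cong_sym cong_trans by (metis mult_1)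
    qed
    hence "\<chi> (f (a * b)) = \<chi> (f a * f b)"
      using that by (intro real_character_cong[OF \<chi>] cop) auto
    thus ?thesis
      using real_character_mult[OF \<chi>] cop that by simp
  qed
  moreover have "\<chi> (f a) = \<chi> (f b)" if "coprime a m" "[a = b] (mod m)" for a b
  proof (rule real_character_cong[OF \<chi> cop[OF that(1)] glue])
    show "[f a = f b] (mod m)" using fm that(2) cong_sym cong_trans by meson
    show "[f a = f b] (mod l)" using fl cong_sym cong_trans by meson
  qed
  moreover have "\<chi> (f a) \<in> {1, -1}" if "coprime a m" for a
    using real_character_values[OF \<chi> cop[OF that]] .
  ultimately show ?thesis
    unfolding real_character_def f_def by blast
qed

text \<open>The two components multiply to \<open>\<chi>\<close> because the Chinese remainder solutions for
  \<open>(a, 1)\<close> and \<open>(1, a)\<close> multiply to \<open>a\<close>.\<close>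

lemma real_character_split:
  assumes \<chi>: "real_character (m * l) \<chi>" and cop: "coprime m l"
  obtains \<chi>\<^sub>1 \<chi>\<^sub>2 where "real_character m \<chi>\<^sub>1" "real_character l \<chi>\<^sub>2"
    "\<And>a. coprime a (m * l) \<Longrightarrow> \<chi> a = \<chi>\<^sub>1 a * \<chi>\<^sub>2 a"
proof -
  obtain u v where uv: "u * l + v * m = 1"
    using bezout_int[of l m] cop by (metis coprime_iff_gcd_eq_1 gcd.commute)
  define f where "f a = 1 + u * l * (a - 1)" for a
  define g where "g a = 1 + v * m * (a - 1)" for a
  have rf: "real_character m (\<lambda>a. \<chi> (f a))"
    unfolding f_def by (rule real_character_component[OF \<chi> uv])
  have rg: "real_character l (\<lambda>a. \<chi> (g a))"
    unfolding g_def
    by (rule real_character_component[of l m]) (use \<chi> uv in \<open>simp_all add: mult.commute add.commute\<close>)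
  have "\<chi> a = \<chi> (f a) * \<chi> (g a)" if a: "coprime a (m * l)" for a
  proof -
    have "f a * g a = 1 + (u * l + v * m) * (a - 1) + m * l * (u * v * (a - 1)\<^sup>2)"
      by (simp add: f_def g_def algebra_simps power2_eq_square)
    hence "[a = f a * g a] (mod m * l)"
      by (simp add: uv cong_iff_dvd_diff)
    moreover from this have "coprime (f a * g a) (m * l)"
      using a cong_imp_coprime by blast
    ultimately show ?thesis
      using real_character_cong[OF \<chi> a] real_character_mult[OF \<chi>, of "f a" "g a"] by simp
  qed
  thus ?thesis using that rf rg by blast
qed

text \<open>Splitting off the full power of one prime divisor at a time. The modulus \<open>1\<close> has to be
  treated with \<open>d = 1\<close>: then \<open>a = 0\<close> is admissible, and \<open>kronecker d 0\<close> is \<open>1\<close> for no other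
  \<open>d\<close>. For larger moduli \<open>a \<noteq> 0\<close>, as \<open>kronecker_mult_left\<close> requires.\<close>

theorem real_character_is_kronecker:
  assumes "n > 0" "real_character n \<chi>"
  shows "\<exists>d. d \<noteq> 0 \<and> ([d = 0] (mod 4) \<or> [d = 1] (mod 4)) \<and>
           (\<forall>a. coprime a n \<longrightarrow> \<chi> a = kronecker d a)"
  using assms
proof (induction "nat n" arbitrary: n \<chi> rule: less_induct)
  case less
  show ?case
  proof (cases "n = 1")
    case True
    have "\<chi> a = \<chi> 1" for a
      by (rule real_character_cong[OF less.prems(2)]) (auto simp: True)
    thus ?thesis
      using real_character_one[OF less.prems(2)]
      by (intro exI[of _ 1]) (auto simp: kronecker_1_left)
  next
    case False
    with less.prems(1) obtain p where p: "prime p" "p dvd n"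
      using prime_divisor_exists[of n] by auto
    define k where "k = multiplicity p n - 1"
    have "multiplicity p n > 0"
      by (rule multiplicity_gt_zero_iff[THEN iffD2]) (use p less.prems(1) in auto)
    hence k: "multiplicity p n = Suc k" by (simp add: k_def)
    obtain m where m: "n = p ^ Suc k * m" "\<not> p dvd m"
      using multiplicity_decompose'[of n p] p less.prems(1) k by (metis less_irrefl not_prime_unit)
    have pk: "p ^ Suc k > 1"
      using prime_gt_1_int[OF p(1)] by (intro one_less_power) auto
    have m0: "m > 0"
      using less.prems(1) m(1) pk by (simp add: zero_less_mult_iff)
    have "nat m < nat n"
      using m0 pk m(1) by (simp add: nat_mono_iff)
    have cop: "coprime (p ^ Suc k) m"
      using m(2) p(1) by (simp add: prime_imp_coprime)
    obtain \<chi>\<^sub>1 \<chi>\<^sub>2 where split: "real_character (p ^ Suc k) \<chi>\<^sub>1" "real_character m \<chi>\<^sub>2"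
        "\<And>a. coprime a n \<Longrightarrow> \<chi> a = \<chi>\<^sub>1 a * \<chi>\<^sub>2 a"
      using real_character_split[OF less.prems(2)[unfolded m(1)] cop] m(1) by metis
    obtain d where d: "d \<noteq> 0" "[d = 0] (mod 4) \<or> [d = 1] (mod 4)"
        "\<And>a. coprime a m \<Longrightarrow> \<chi>\<^sub>2 a = kronecker d a"
      using less.hyps[OF \<open>nat m < nat n\<close> m0 split(2)] by blast
    have "\<exists>e. e \<noteq> 0 \<and> ([e = 0] (mod 4) \<or> [e = 1] (mod 4)) \<and>
            (\<forall>a. coprime a p \<longrightarrow> \<chi>\<^sub>1 a = kronecker e a)"
    proof (cases "p = 2")
      case True
      obtain e where "e \<in> {4, -4, 8, -8}" "\<forall>a. odd a \<longrightarrow> \<chi>\<^sub>1 a = kronecker e a"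
        using real_character_power_2[of k \<chi>\<^sub>1] split(1) True by auto
      thus ?thesis
        using True by (intro exI[of _ e]) (auto simp: cong_def)
    next
      case False
      have "prime_discriminant p \<noteq> 0"
        using p(1) by (auto simp: prime_discriminant_def)
      moreover have "[prime_discriminant p = 1] (mod 4)"
        using odd_prime_mod_4(2)[OF p(1) False]
        by (auto simp: prime_discriminant_def cong_def zmod_zminus1_eq_if)
      moreover have "(1 :: int) \<noteq> 0" "[1 = 1] (mod (4 :: int))"
        by simp_all
      ultimately show ?thesis
        using real_character_odd_prime_power[OF p(1) False split(1)] by blast
    qed
    then obtain e where e: "e \<noteq> 0" "[e = 0] (mod 4) \<or> [e = 1] (mod 4)"
        "\<And>a. coprime a p \<Longrightarrow> \<chi>\<^sub>1 a = kronecker e a"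
      by blast
    have "[e * d = 0] (mod 4) \<or> [e * d = 1] (mod 4)"
      using cong_mult[of e _ 4 d] d(2) e(2) by fastforce
    moreover have "\<chi> a = kronecker (e * d) a" if a: "coprime a n" for a
    proof -
      have "a \<noteq> 0" using a False less.prems(1) by auto
      moreover have "coprime a p" "coprime a m"
        using a by (auto simp: m(1))
      ultimately show ?thesis
        using split(3)[OF a] d e by (simp add: kronecker_mult_left)
    qed
    ultimately show ?thesis
      using d(1) e(1) by (intro exI[of _ "e * d"]) auto
  qed
qed

section \<open>The power permutation\<close>

lemma power_perm_mult:
  fixes G (structure)
  assumes "group G"
  shows "power_perm G (a * b) = power_perm G a \<circ> power_perm G b"
proof -
  interpret group G by fact
  show ?thesis
    by (rule ext) (simp add: power_perm_def perm_restrict_def int_pow_pow mult.commute)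
qed

lemma power_perm_cong:
  fixes G (structure)
  assumes "group G" "finite (carrier G)" "[a = b] (mod int (Coset.order G))"
  shows "power_perm G a = power_perm G b"
proof -
  interpret group G by fact
  obtain k where k: "b = a + int (Coset.order G) * k"
    using assms(3) by (auto simp: cong_iff_lin)
  have "g [^] b = g [^] a" if g: "g \<in> carrier G" for g
  proof -
    have "g [^] (int (Coset.order G) * k) = (g [^] Coset.order G) [^] k"
      using g by (simp add: int_pow_pow flip: int_pow_int)
    thus ?thesis
      using g by (simp add: k int_pow_mult pow_order_eq_1)
  qed
  thus ?thesis
    by (intro ext) (simp add: power_perm_def perm_restrict_def)
qed

lemma real_character_group_symbol_el:
  fixes G (structure)
  assumes G: "group G" "finite (carrier G)"
  shows "real_character (int (Coset.order G)) (\<lambda>a. group_symbol_el a G)"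
proof -
  have perm: "permutation (power_perm G a)" if "coprime a (int (Coset.order G))" for a
    using power_perm_permutes[OF G that] G(2) permutation_permutes by blast
  show ?thesis
    unfolding real_character_def group_symbol_el_def
  proof (intro conjI allI impI)
    show "sign (power_perm G a) \<in> {1, -1}" for a
      by (simp add: sign_def)
    show "sign (power_perm G (a * b)) = sign (power_perm G a) * sign (power_perm G b)"
      if "coprime a (int (Coset.order G))" "coprime b (int (Coset.order G))" for a b
      using that by (simp add: power_perm_mult[OF G(1)] sign_compose perm)
    show "sign (power_perm G a) = sign (power_perm G b)"
      if "[a = b] (mod int (Coset.order G))" for a b
      using power_perm_cong[OF G that] by simp
  qed
qed

theorem corollary4p10:
  fixes G :: "('a, 'b) monoid_scheme"
  assumes "Group.group G" and "finite (carrier G)"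
  shows "\<exists>d :: int. \<forall>a :: int. coprime a (int (Coset.order G)) \<longrightarrow>
           kronecker_defined d a \<and> group_symbol_el a G = kronecker d a"
proof -
  interpret group G by fact
  have "int (Coset.order G) > 0"
    using assms(2) order_gt_0_iff_finite by simp
  from real_character_is_kronecker[OF this real_character_group_symbol_el[OF assms]]
  show ?thesis
    by (auto simp: kronecker_defined_def)
qed

end
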